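(* Let $\ell\in\mathbb N$. There exists an acute lattice triangle of lattice perimeter $\ell$ whose circumcenter is a lattice point if and only if $\ell$ is even and either $\ell=8$ or $\ell\ge 12$.
   Context: $\mathbb N$ denotes the positive integers. A lattice point is an element of $\mathbb Z^2\subseteq\mathbb R^2$. A lattice triangle is a (nondegenerate) triangle in $\mathbb R^2$ whose three vertices are lattice points. The lattice length of a segment joining two lattice points is the number of lattice points on the segment (endpoints included) minus one. The lattice perimeter of a lattice triangle is the sum of the lattice lengths of its three sides. A triangle is acute if all its interior angles are strictly less than $\pi/2$. *)

theory Defs
  imports "HOL-Analysis.Analysis"
begin

definition lattice_points :: "(real ^ 2) set" where
  "lattice_points = {x. \<forall>i. x $ i \<in> \<int>}"

text \<open>
  The subtraction below is on naturals. It does not truncate when the endpoints are lattice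
  points: the set then contains them, and it is finite because a segment is bounded.
\<close>

definition lattice_length :: "real ^ 2 \<Rightarrow> real ^ 2 \<Rightarrow> nat" where
  "lattice_length a b = card (closed_segment a b \<inter> lattice_points) - 1"

definition lattice_perimeter :: "real ^ 2 \<Rightarrow> real ^ 2 \<Rightarrow> real ^ 2 \<Rightarrow> nat" where
  "lattice_perimeter a b c = lattice_length a b + lattice_length b c + lattice_length c a"

definition lattice_triangle :: "real ^ 2 \<Rightarrow> real ^ 2 \<Rightarrow> real ^ 2 \<Rightarrow> bool" where
  "lattice_triangle a b c \<longleftrightarrow>
     a \<in> lattice_points \<and> b \<in> lattice_points \<and> c \<in> lattice_points \<and> \<not> collinear {a, b, c}"

text \<open>The unsigned angle at the middle argument, in \<open>[0, \<pi>]\<close>; only meaningful if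
  \<open>a \<noteq> b\<close> and \<open>c \<noteq> b\<close>.\<close>

definition angle_at :: "real ^ 2 \<Rightarrow> real ^ 2 \<Rightarrow> real ^ 2 \<Rightarrow> real" where
  "angle_at a b c = arccos (((a - b) \<bullet> (c - b)) / (norm (a - b) * norm (c - b)))"

definition acute_triangle :: "real ^ 2 \<Rightarrow> real ^ 2 \<Rightarrow> real ^ 2 \<Rightarrow> bool" where
  "acute_triangle a b c \<longleftrightarrow>
     angle_at b a c < pi / 2 \<and> angle_at a b c < pi / 2 \<and> angle_at a c b < pi / 2"

text \<open>Well defined for nondegenerate triangles, by \<open>ex1_equidistant\<close> below.\<close>

definition circumcenter :: "real ^ 2 \<Rightarrow> real ^ 2 \<Rightarrow> real ^ 2 \<Rightarrow> real ^ 2" where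
  "circumcenter a b c = (THE p. dist p a = dist p b \<and> dist p a = dist p c)"

lemma dist_eq_iff_2:
  fixes p a b :: "real ^ 2"
  shows "dist p a = dist p b \<longleftrightarrow>
    2 * (p $ 1 * (b $ 1 - a $ 1) + p $ 2 * (b $ 2 - a $ 2)) =
    (b $ 1)\<^sup>2 + (b $ 2)\<^sup>2 - (a $ 1)\<^sup>2 - (a $ 2)\<^sup>2"
proof -
  have "dist p a = dist p b \<longleftrightarrow> (p $ 1 - a $ 1)\<^sup>2 + (p $ 2 - a $ 2)\<^sup>2 =
      (p $ 1 - b $ 1)\<^sup>2 + (p $ 2 - b $ 2)\<^sup>2"
    by (simp add: dist_vec_def L2_set_def sum_2 dist_real_def)
  then show ?thesis
    by (auto simp: power2_eq_square algebra_simps)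
qed

lemma det_nonzero_if_not_collinear:
  fixes a b c :: "real ^ 2"
  assumes "\<not> collinear {a, b, c}"
  shows "(b $ 1 - a $ 1) * (c $ 2 - a $ 2) - (b $ 2 - a $ 2) * (c $ 1 - a $ 1) \<noteq> 0"
proof
  define u v where "u = b - a" and "v = c - a"
  assume "(b $ 1 - a $ 1) * (c $ 2 - a $ 2) - (b $ 2 - a $ 2) * (c $ 1 - a $ 1) = 0"
  then have det: "u $ 1 * v $ 2 = u $ 2 * v $ 1"
    by (simp add: u_def v_def)
  have "collinear {0, u, v}"
  proof (cases "u = 0")
    case False
    then consider "u $ 1 \<noteq> 0" | "u $ 2 \<noteq> 0"
      by (auto simp: vec_eq_iff forall_2)
    then have "\<exists>k. v = k *\<^sub>R u"
    proof cases
      case 1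
      then have "v = (v $ 1 / u $ 1) *\<^sub>R u"
        using det by (simp add: vec_eq_iff forall_2 field_simps)
      then show ?thesis ..
    next
      case 2
      then have "v = (v $ 2 / u $ 2) *\<^sub>R u"
        using det by (simp add: vec_eq_iff forall_2 field_simps)
      then show ?thesis ..
    qed
    then show ?thesis
      by (simp add: collinear_lemma)
  qed simp
  then have "collinear {b, a, c}"
    unfolding u_def v_def by (subst collinear_3) auto
  with assms show False
    by (simp add: insert_commute)
qed

lemma ex1_equidistant:
  fixes a b c :: "real ^ 2"
  assumes "\<not> collinear {a, b, c}"
  shows "\<exists>!p. dist p a = dist p b \<and> dist p a = dist p c"
proof -
  define u1 u2 v1 v2 where "u1 = b $ 1 - a $ 1" and "u2 = b $ 2 - a $ 2"
    and "v1 = c $ 1 - a $ 1" and "v2 = c $ 2 - a $ 2"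
  define r s where "r = ((b $ 1)\<^sup>2 + (b $ 2)\<^sup>2 - (a $ 1)\<^sup>2 - (a $ 2)\<^sup>2) / 2"
    and "s = ((c $ 1)\<^sup>2 + (c $ 2)\<^sup>2 - (a $ 1)\<^sup>2 - (a $ 2)\<^sup>2) / 2"
  define D where "D = u1 * v2 - u2 * v1"
  have D: "D \<noteq> 0"
    using det_nonzero_if_not_collinear[OF assms] by (simp add: D_def u1_def u2_def v1_def v2_def)
  have eq: "dist p a = dist p b \<and> dist p a = dist p c \<longleftrightarrow>
      p $ 1 * u1 + p $ 2 * u2 = r \<and> p $ 1 * v1 + p $ 2 * v2 = s" for p
    unfolding dist_eq_iff_2 u1_def u2_def v1_def v2_def r_def s_def by auto
  have sol: "x * u1 + y * u2 = r \<and> x * v1 + y * v2 = s \<longleftrightarrow>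
      x = (r * v2 - s * u2) / D \<and> y = (u1 * s - v1 * r) / D" (is "?L \<longleftrightarrow> ?R") for x y
  proof
    assume ?L
    then have "x * D = r * v2 - s * u2" "y * D = u1 * s - v1 * r"
      unfolding D_def by (auto simp: algebra_simps)
    with D show ?R
      by (simp add: field_simps)
  next
    assume R: ?R
    have "x * u1 + y * u2 = (r * D) / D" "x * v1 + y * v2 = (s * D) / D"
      unfolding R[THEN conjunct1] R[THEN conjunct2] times_divide_eq_left add_divide_distrib[symmetric]
      by (simp_all add: D_def algebra_simps)
    with D show ?L
      by simp
  qed
  show ?thesis
    unfolding eq sol
    by (rule ex1I[of _ "vector [(r * v2 - s * u2) / D, (u1 * s - v1 * r) / D]"])
      (auto simp: vec_eq_iff forall_2)
qed

end

theory Submission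
  imports Defs
begin

text \<open>
  Put the circumcenter at the origin, so that the vertices are lattice points with a common squared
  norm \<open>N\<close>. A side is \<open>g p\<close> with \<open>g\<close> its lattice length and \<open>p\<close> primitive; the sum of its two endpoints
  is orthogonal to \<open>p\<close>, hence an integer multiple \<open>k\<close> of the rotation of \<open>p\<close> by a right angle. So
  \<open>4 N = |p|\<^sup>2 (g\<^sup>2 + k\<^sup>2)\<close>, and \<open>k / g\<close> is the cotangent of the opposite angle, which is positive for an
  acute triangle. The cotangent relation of a triangle then leaves finitely many \<open>(g, k)\<close> for each
  perimeter. For the perimeters 2, 4, 6, 10 all of them are excluded because \<open>|p|\<^sup>2\<close> is never divisible
  by 3 or 4, and is 2 modulo 4 if \<open>g\<close> is odd. The perimeter is even because \<open>x + y\<close> has the parity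
  of \<open>N\<close> at all vertices.

  Conversely, for \<open>0 < v < u\<close> the triangle \<open>(-u, -v), (u, -v), (v, u)\<close> has lattice perimeter
  \<open>3 u + v + gcd (u - v) (u + v)\<close>, and \<open>v \<in> {1, 3, 9}\<close> yields every required value except 22, which is
  attained by \<open>(-7, -1), (7, -1), (-5, 5)\<close>.
\<close>

section \<open>Integer coordinates and lattice length\<close>

definition lattice_vec :: "int \<Rightarrow> int \<Rightarrow> real ^ 2" where
  "lattice_vec x y = vector [of_int x, of_int y]"

lemma lattice_vec_nth [simp]:
  "lattice_vec x y $ 1 = of_int x" "lattice_vec x y $ 2 = of_int y"
  by (simp_all add: lattice_vec_def)

lemma lattice_vec_in_lattice_points [simp]: "lattice_vec x y \<in> lattice_points"
  by (simp add: lattice_points_def forall_2)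

lemma lattice_points_cases:
  assumes "a \<in> lattice_points"
  obtains x y where "a = lattice_vec x y"
proof -
  from assms obtain x y where "a $ 1 = of_int x" "a $ 2 = of_int y"
    by (auto simp: lattice_points_def forall_2 elim!: Ints_cases)
  then have "a = lattice_vec x y"
    by (simp add: vec_eq_iff forall_2)
  then show ?thesis ..
qed

lemma lattice_vec_eq_iff [simp]: "lattice_vec x y = lattice_vec x' y' \<longleftrightarrow> x = x' \<and> y = y'"
  by (simp add: vec_eq_iff forall_2)

lemma lattice_vec_diff: "lattice_vec x y - lattice_vec x' y' = lattice_vec (x - x') (y - y')"
  by (simp add: vec_eq_iff forall_2)

lemma inner_lattice_vec: "lattice_vec x y \<bullet> lattice_vec x' y' = of_int (x * x' + y * y')"
  by (simp add: inner_vec_def sum_2)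

text \<open>Along the primitive direction \<open>(p, q)\<close> the point with parameter
  \<open>t\<close> is displaced by \<open>t * g\<close> times \<open>(p, q)\<close>. A Bezout
  combination of its integer displacements equals \<open>t * g\<close>, so this is an integer and
  serves as the index \<open>i\<close>.\<close>

lemma closed_segment_lattice_points:
  fixes x y x' y' :: int
  assumes ne: "(x, y) \<noteq> (x', y')"
  defines "g \<equiv> gcd (x' - x) (y' - y)"
  shows "closed_segment (lattice_vec x y) (lattice_vec x' y') \<inter> lattice_points =
    (\<lambda>i. lattice_vec (x + i * ((x' - x) div g)) (y + i * ((y' - y) div g))) ` {0..g}"
    (is "?L = ?f ` _")
proof -
  define p q where "p = (x' - x) div g" and "q = (y' - y) div g"
  have g: "g > 0"
    using ne by (auto simp: g_def)
  have pq: "x' = x + g * p" "y' = y + g * q"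
    by (simp_all add: p_def q_def g_def)
  have cop: "coprime p q"
    unfolding p_def q_def g_def by (rule div_gcd_coprime) (use ne in auto)
  have "?L \<subseteq> ?f ` {0..g}"
  proof
    fix z assume z: "z \<in> ?L"
    then obtain m n where mn: "z = lattice_vec m n"
      by (auto elim: lattice_points_cases)
    from z obtain t where t: "0 \<le> t" "t \<le> 1"
      and zt: "z = (1 - t) *\<^sub>R lattice_vec x y + t *\<^sub>R lattice_vec x' y'"
      by (auto simp: closed_segment_def)
    have 1: "of_int (m - x) = (t * of_int g) * of_int p" "of_int (n - y) = (t * of_int g) * of_int q"
      using zt unfolding mn by (simp_all add: vec_eq_iff forall_2 pq algebra_simps)
    obtain r s where rs: "r * p + s * q = 1"
      using cop by (metis bezout_int coprime_imp_gcd_eq_1)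
    define i where "i = r * (m - x) + s * (n - y)"
    have "of_int i = (t * of_int g) * of_int (r * p + s * q)"
      unfolding i_def of_int_add of_int_mult 1 by (simp add: algebra_simps)
    then have i: "of_int i = t * of_int g"
      by (simp add: rs)
    have "(of_int (m - x) :: real) = of_int (i * p)" "(of_int (n - y) :: real) = of_int (i * q)"
      unfolding 1 of_int_mult i by simp_all
    then have "m = x + i * p" "n = y + i * q"
      unfolding of_int_eq_iff by simp_all
    moreover have "(0::real) \<le> of_int i" "(of_int i :: real) \<le> of_int g"
      unfolding i using t g by (simp_all add: mult_left_le_one_le)
    ultimately show "z \<in> ?f ` {0..g}"
      unfolding mn p_def q_def by auto
  qed
  moreover have "?f i \<in> ?L" if "i \<in> {0..g}" for i
  proof -
    have "?f i = (1 - of_int i / of_int g) *\<^sub>R lattice_vec x y + (of_int i / of_int g) *\<^sub>R lattice_vec x' y'"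
      using g unfolding p_def[symmetric] q_def[symmetric]
      by (simp add: vec_eq_iff forall_2 pq field_simps)
    then have "?f i \<in> closed_segment (lattice_vec x y) (lattice_vec x' y')"
      using that g unfolding closed_segment_def
      by (auto intro!: exI[of _ "of_int i / of_int g"])
    then show ?thesis
      by simp
  qed
  ultimately show ?thesis
    by blast
qed

lemma lattice_length_lattice_vec:
  assumes ne: "(x, y) \<noteq> (x', y')"
  shows "int (lattice_length (lattice_vec x y) (lattice_vec x' y')) = gcd (x - x') (y - y')"
proof -
  define g where "g = gcd (x' - x) (y' - y)"
  have g: "g > 0"
    using ne by (auto simp: g_def)
  define p q where "p = (x' - x) div g" and "q = (y' - y) div g"
  have "x' = x + g * p" "y' = y + g * q"
    by (simp_all add: p_def q_def g_def)
  with ne have "p \<noteq> 0 \<or> q \<noteq> 0"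
    by auto
  then have "inj_on (\<lambda>i. lattice_vec (x + i * p) (y + i * q)) {0..g}"
    by (auto simp: inj_on_def)
  then have "card (closed_segment (lattice_vec x y) (lattice_vec x' y') \<inter> lattice_points) = nat (g + 1)"
    unfolding closed_segment_lattice_points[OF ne] g_def[symmetric] p_def[symmetric] q_def[symmetric]
    by (simp add: card_image)
  then have "int (lattice_length (lattice_vec x y) (lattice_vec x' y')) = g"
    using g by (simp add: lattice_length_def)
  then show ?thesis
    by (metis g_def gcd_neg1_int gcd_neg2_int minus_diff_eq)
qed

section \<open>Angles, circumcenter and collinearity in algebraic form\<close>

text \<open>\<open>arccos\<close> is strictly decreasing with \<open>arccos 0 = pi / 2\<close>, and
  Cauchy-Schwarz keeps the quotient in its domain.\<close>

lemma angle_at_less_pi_half_iff: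
  assumes "a \<noteq> b" "c \<noteq> b"
  shows "angle_at a b c < pi / 2 \<longleftrightarrow> (a - b) \<bullet> (c - b) > 0"
proof -
  have pos: "norm (a - b) * norm (c - b) > 0"
    using assms by simp
  have "\<bar>((a - b) \<bullet> (c - b)) / (norm (a - b) * norm (c - b))\<bar> \<le> 1"
    using pos Cauchy_Schwarz_ineq2[of "a - b" "c - b"] by (simp add: abs_mult)
  then have "angle_at a b c < pi / 2 \<longleftrightarrow> 0 < ((a - b) \<bullet> (c - b)) / (norm (a - b) * norm (c - b))"
    unfolding angle_at_def arccos_0[symmetric] by (subst arccos_less_mono) auto
  then show ?thesis
    using pos by (simp add: zero_less_divide_iff)
qed

lemma circumcenter_eqI:
  assumes "\<not> collinear {a, b, c}" "dist p a = dist p b" "dist p a = dist p c"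
  shows "circumcenter a b c = p"
  unfolding circumcenter_def using ex1_equidistant[OF assms(1)] assms(2,3)
  by (intro the1_equality) auto

lemma circumcenter_equidistant:
  assumes "\<not> collinear {a, b, c}"
  shows "dist (circumcenter a b c) a = dist (circumcenter a b c) b"
    and "dist (circumcenter a b c) a = dist (circumcenter a b c) c"
  using theI'[OF ex1_equidistant[OF assms]] unfolding circumcenter_def by auto

lemma not_collinear_if_det_nonzero:
  fixes a b c :: "real ^ 2"
  assumes "(b $ 1 - a $ 1) * (c $ 2 - a $ 2) - (b $ 2 - a $ 2) * (c $ 1 - a $ 1) \<noteq> 0"
  shows "\<not> collinear {a, b, c}"
proof
  assume "collinear {a, b, c}"
  then obtain u s t where "b - a = s *\<^sub>R u" "c - a = t *\<^sub>R u"
    unfolding collinear_def by blast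
  then have "(b - a) $ 1 * (c - a) $ 2 - (b - a) $ 2 * (c - a) $ 1 = 0"
    by simp
  with assms show False
    by simp
qed

section \<open>Reduction to integer triangles centered at the origin\<close>

text \<open>The equations place the circumcenter at the origin, the determinant is twice the signed
  area, and the inequalities express acuteness at vertices 1, 2, 3 in this order.\<close>

definition centered_acute :: "int \<Rightarrow> int \<Rightarrow> int \<Rightarrow> int \<Rightarrow> int \<Rightarrow> int \<Rightarrow> bool" where
  "centered_acute x1 y1 x2 y2 x3 y3 \<longleftrightarrow>
     x1\<^sup>2 + y1\<^sup>2 = x2\<^sup>2 + y2\<^sup>2 \<and> x1\<^sup>2 + y1\<^sup>2 = x3\<^sup>2 + y3\<^sup>2 \<and>
     (x2 - x1) * (y3 - y1) - (y2 - y1) * (x3 - x1) \<noteq> 0 \<and>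
     (x2 - x1) * (x3 - x1) + (y2 - y1) * (y3 - y1) > 0 \<and>
     (x1 - x2) * (x3 - x2) + (y1 - y2) * (y3 - y2) > 0 \<and>
     (x1 - x3) * (x2 - x3) + (y1 - y3) * (y2 - y3) > 0"

lemma centered_acute_distinct:
  assumes "centered_acute x1 y1 x2 y2 x3 y3"
  shows "(x1, y1) \<noteq> (x2, y2)" "(x2, y2) \<noteq> (x3, y3)" "(x3, y3) \<noteq> (x1, y1)"
  using assms by (auto simp: centered_acute_def)

lemma dist_lattice_vec_eq_iff:
  "dist (lattice_vec u v) (lattice_vec x y) = dist (lattice_vec u v) (lattice_vec x' y') \<longleftrightarrow>
     (x - u)\<^sup>2 + (y - v)\<^sup>2 = (x' - u)\<^sup>2 + (y' - v)\<^sup>2"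
proof -
  have "dist (lattice_vec u v) (lattice_vec x y) =
      sqrt (of_int ((x - u)\<^sup>2 + (y - v)\<^sup>2))" for x y
    by (simp add: dist_vec_def L2_set_def sum_2 dist_real_def power2_commute)
  then show ?thesis
    by (simp only: real_sqrt_eq_iff of_int_eq_iff)
qed

text \<open>The offset \<open>(u, v)\<close> is arbitrary to serve both directions of the reduction:
  it is the circumcenter of a given triangle in one and the origin in the other.\<close>

lemma centered_acute_iff:
  defines "t \<equiv> \<lambda>u v x y. lattice_vec (x + u) (y + v)"
  shows "centered_acute x1 y1 x2 y2 x3 y3 \<longleftrightarrow>
     lattice_triangle (t u v x1 y1) (t u v x2 y2) (t u v x3 y3) \<and>
     acute_triangle (t u v x1 y1) (t u v x2 y2) (t u v x3 y3) \<and>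
     circumcenter (t u v x1 y1) (t u v x2 y2) (t u v x3 y3) = lattice_vec u v"
  (is "?C \<longleftrightarrow> ?T \<and> ?A \<and> ?Z")
proof -
  let ?a = "t u v x1 y1" and ?b = "t u v x2 y2" and ?c = "t u v x3 y3"
  have det: "\<not> collinear {?a, ?b, ?c} \<longleftrightarrow> (x2 - x1) * (y3 - y1) - (y2 - y1) * (x3 - x1) \<noteq> 0"
    (is "_ \<longleftrightarrow> ?D \<noteq> 0")
  proof -
    have "(?b $ 1 - ?a $ 1) * (?c $ 2 - ?a $ 2) - (?b $ 2 - ?a $ 2) * (?c $ 1 - ?a $ 1) = of_int ?D"
      by (simp add: t_def)
    then show ?thesis
      using det_nonzero_if_not_collinear[of ?a ?b ?c] not_collinear_if_det_nonzero[where a = ?a and b = ?b and c = ?c]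
      by (metis of_int_eq_0_iff)
  qed
  have T: "?T \<longleftrightarrow> ?D \<noteq> 0"
    unfolding lattice_triangle_def det by (simp add: t_def)
  \<comment> \<open>Angles and circumcenter are meaningful only for nondegenerate triangles, hence
    the condition \<open>?D \<noteq> 0\<close> here and in \<open>Z\<close>.\<close>
  have A: "?A \<longleftrightarrow> (x2 - x1) * (x3 - x1) + (y2 - y1) * (y3 - y1) > 0 \<and>
     (x1 - x2) * (x3 - x2) + (y1 - y2) * (y3 - y2) > 0 \<and>
     (x1 - x3) * (x2 - x3) + (y1 - y3) * (y2 - y3) > 0" if "?D \<noteq> 0"
  proof -
    have ne: "(x1, y1) \<noteq> (x2, y2)" "(x2, y2) \<noteq> (x3, y3)" "(x3, y3) \<noteq> (x1, y1)"
      using that by auto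
    have ne': "?a \<noteq> ?b" "?c \<noteq> ?b" "?a \<noteq> ?c" "?b \<noteq> ?a" "?b \<noteq> ?c" "?c \<noteq> ?a"
      using ne by (auto simp: t_def)
    show ?thesis
      unfolding acute_triangle_def angle_at_less_pi_half_iff[OF ne'(4,6)]
        angle_at_less_pi_half_iff[OF ne'(1,2)] angle_at_less_pi_half_iff[OF ne'(3,5)]
      unfolding t_def lattice_vec_diff inner_lattice_vec of_int_0_less_iff by simp
  qed
  have Z: "?Z \<longleftrightarrow> x1\<^sup>2 + y1\<^sup>2 = x2\<^sup>2 + y2\<^sup>2 \<and> x1\<^sup>2 + y1\<^sup>2 = x3\<^sup>2 + y3\<^sup>2" (is "_ \<longleftrightarrow> ?E") if "?D \<noteq> 0"
  proof -
    have E: "?E \<longleftrightarrow> dist (lattice_vec u v) ?a = dist (lattice_vec u v) ?b \<and>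
        dist (lattice_vec u v) ?a = dist (lattice_vec u v) ?c"
      by (simp add: t_def dist_lattice_vec_eq_iff)
    show ?thesis
      unfolding E using circumcenter_eqI circumcenter_equidistant det that by metis
  qed
  show ?thesis
    unfolding centered_acute_def T using A Z by blast
qed

lemma acute_lattice_triangle_iff_centered_acute:
  "(\<exists>a b c :: real ^ 2. lattice_triangle a b c \<and> acute_triangle a b c \<and>
      lattice_perimeter a b c = l \<and> circumcenter a b c \<in> lattice_points) \<longleftrightarrow>
   (\<exists>x1 y1 x2 y2 x3 y3. centered_acute x1 y1 x2 y2 x3 y3 \<and>
      gcd (x1 - x2) (y1 - y2) + gcd (x2 - x3) (y2 - y3) + gcd (x3 - x1) (y3 - y1) = int l)"
  (is "?L \<longleftrightarrow> ?R")
proof -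
  have per: "int (lattice_perimeter (lattice_vec (x1 + u) (y1 + v)) (lattice_vec (x2 + u) (y2 + v))
        (lattice_vec (x3 + u) (y3 + v))) =
      gcd (x1 - x2) (y1 - y2) + gcd (x2 - x3) (y2 - y3) + gcd (x3 - x1) (y3 - y1)"
    if "centered_acute x1 y1 x2 y2 x3 y3" for x1 y1 x2 y2 x3 y3 u v
    using centered_acute_distinct[OF that]
    by (simp add: lattice_perimeter_def lattice_length_lattice_vec)
  show ?thesis
  proof
    assume ?L
    then obtain a b c where tri: "lattice_triangle a b c" "acute_triangle a b c"
      and l: "lattice_perimeter a b c = l" and cc: "circumcenter a b c \<in> lattice_points"
      by blast
    from cc obtain u v where o: "circumcenter a b c = lattice_vec u v"
      by (rule lattice_points_cases)
    have ex: "\<exists>x y. z = lattice_vec (x + u) (y + v)" if z: "z \<in> lattice_points" for z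
    proof -
      from z obtain x y where "z = lattice_vec x y"
        by (rule lattice_points_cases)
      then have "z = lattice_vec ((x - u) + u) ((y - v) + v)"
        by simp
      then show ?thesis
        by blast
    qed
    from tri(1) obtain x1 y1 x2 y2 x3 y3 where
      abc: "a = lattice_vec (x1 + u) (y1 + v)" "b = lattice_vec (x2 + u) (y2 + v)"
        "c = lattice_vec (x3 + u) (y3 + v)"
      unfolding lattice_triangle_def using ex by metis
    have "centered_acute x1 y1 x2 y2 x3 y3"
      unfolding centered_acute_iff[where u = u and v = v] using tri o unfolding abc by blast
    then show ?R
      using per[of x1 y1 x2 y2 x3 y3 u v] l unfolding abc by metis
  next
    assume ?R
    then obtain x1 y1 x2 y2 x3 y3 where R: "centered_acute x1 y1 x2 y2 x3 y3"
      "gcd (x1 - x2) (y1 - y2) + gcd (x2 - x3) (y2 - y3) + gcd (x3 - x1) (y3 - y1) = int l"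
      by blast
    with per[of x1 y1 x2 y2 x3 y3 0 0] centered_acute_iff[of x1 y1 x2 y2 x3 y3 0 0]
    show ?L
      by (metis add_0_right lattice_vec_in_lattice_points of_nat_eq_iff)
  qed
qed

section \<open>Chords of a circle about the origin\<close>

text \<open>Squares are 0 or 1 modulo 4 and modulo 3, and coprimality prevents both from being
  0.\<close>

lemma coprime_sum_squares_mod:
  fixes p q :: int
  assumes "coprime p q"
  shows "(p\<^sup>2 + q\<^sup>2) mod 4 = 1 \<or> (p\<^sup>2 + q\<^sup>2) mod 4 = 2" "(p\<^sup>2 + q\<^sup>2) mod 3 \<noteq> 0"
proof -
  have sq4: "x\<^sup>2 mod 4 = (if even x then 0 else 1)" for x :: int
  proof (cases "even x")
    case False
    then obtain y where "x = 2 * y + 1"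
      by (rule oddE)
    then have "x\<^sup>2 = 4 * (y\<^sup>2 + y) + 1"
      by (simp add: power2_eq_square algebra_simps)
    with False show ?thesis
      by (simp del: distrib_left_numeral)
  qed (auto elim!: evenE simp: power2_eq_square)
  have sq3: "x\<^sup>2 mod 3 = (if 3 dvd x then 0 else 1)" for x :: int
  proof -
    consider "x mod 3 = 0" | "x mod 3 = 1" | "x mod 3 = 2"
      by linarith
    then show ?thesis
      by cases (simp_all add: dvd_eq_mod_eq_0 power_mod[of x 3 2, symmetric])
  qed
  have "\<not> (even p \<and> even q)" "\<not> (3 dvd p \<and> 3 dvd q)"
    using coprime_common_divisor[OF assms] by fastforce+
  moreover have "(p\<^sup>2 + q\<^sup>2) mod 4 = (p\<^sup>2 mod 4 + q\<^sup>2 mod 4) mod 4"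
    "(p\<^sup>2 + q\<^sup>2) mod 3 = (p\<^sup>2 mod 3 + q\<^sup>2 mod 3) mod 3"
    by (simp_all only: mod_add_eq)
  ultimately show "(p\<^sup>2 + q\<^sup>2) mod 4 = 1 \<or> (p\<^sup>2 + q\<^sup>2) mod 4 = 2" "(p\<^sup>2 + q\<^sup>2) mod 3 \<noteq> 0"
    unfolding sq4 sq3 by (auto split: if_splits)
qed

text \<open>The equation involving \<open>(u, v)\<close> says that \<open>k / g\<close> is, up to the sign given by the orientation,
  the cotangent of the angle under which the chord is seen from \<open>(u, v)\<close>.\<close>

lemma lattice_chord:
  fixes x y x' y' :: int
  assumes circ: "x\<^sup>2 + y\<^sup>2 = N" "x'\<^sup>2 + y'\<^sup>2 = N" and ne: "(x, y) \<noteq> (x', y')"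
  defines "g \<equiv> gcd (x - x') (y - y')"
  obtains k P where "4 * N = P * (g\<^sup>2 + k\<^sup>2)"
    "\<And>u v. u\<^sup>2 + v\<^sup>2 = N \<Longrightarrow>
      k * ((x' - x) * (v - y) - (y' - y) * (u - x)) = g * ((x - u) * (x' - u) + (y - v) * (y' - v))"
    "P > 0" "g > 0"
    "P mod 4 = 1 \<or> P mod 4 = 2" "P mod 3 \<noteq> 0" "odd g \<Longrightarrow> P mod 4 = 2"
proof -
  define p q where "p = (x - x') div g" and "q = (y - y') div g"
  define P where "P = p\<^sup>2 + q\<^sup>2"
  have g: "g > 0"
    using ne by (auto simp: g_def)
  have pq: "x - x' = g * p" "y - y' = g * q"
    by (simp_all add: p_def q_def g_def)
  have cop: "coprime p q"
    unfolding p_def q_def g_def by (rule div_gcd_coprime) (use ne in auto)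
  \<comment> \<open>Equal norms make the difference of the endpoints orthogonal to their
    sum.\<close>
  have "g * (p * (x + x') + q * (y + y')) = (x - x') * (x + x') + (y - y') * (y + y')"
    unfolding pq by (simp add: algebra_simps)
  also have "\<dots> = 0"
    using circ by (simp add: algebra_simps power2_eq_square)
  finally have orth: "p * (x + x') = - (q * (y + y'))"
    using g by simp
  obtain r s where rs: "r * p + s * q = 1"
    using cop by (metis bezout_int coprime_imp_gcd_eq_1)
  \<comment> \<open>The Bezout coefficients of \<open>(p, q)\<close> extract the factor by which the
    sum of the endpoints is a multiple of \<open>(- q, p)\<close>.\<close>
  define k where "k = r * (y + y') - s * (x + x')"
  have "p * k = (r * p + s * q) * (y + y')"
    unfolding k_def using orth by algebra
  then have k1: "y + y' = p * k"
    by (simp add: rs)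
  have "- (q * k) = (r * p + s * q) * (x + x')"
    unfolding k_def using orth by algebra
  then have k2: "x + x' = - (q * k)"
    by (simp add: rs)
  have half: "2 * x = g * p - q * k" "2 * y = g * q + p * k" "2 * x' = - g * p - q * k" "2 * y' = p * k - g * q"
    using pq k1 k2 by simp_all
  have N4: "4 * N = P * (g\<^sup>2 + k\<^sup>2)"
  proof -
    have "4 * N = (2 * x)\<^sup>2 + (2 * y)\<^sup>2"
      using circ(1) by (simp add: power_mult_distrib)
    then show ?thesis
      unfolding half P_def by (simp add: power2_eq_square algebra_simps)
  qed
  show ?thesis
  proof (rule that[of P k, OF N4])
    show "k * ((x' - x) * (v - y) - (y' - y) * (u - x)) = g * ((x - u) * (x' - u) + (y - v) * (y' - v))"
      if uv: "u\<^sup>2 + v\<^sup>2 = N" for u v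
    proof -
      \<comment> \<open>Doubled coordinates permit substituting \<open>half\<close>. Four times the
        determinant is \<open>g * F\<close> and four times the inner product is
        \<open>k * F\<close>, with the common factor
        \<open>F = 2 * k * P + 4 * (q * u - p * v)\<close>.\<close>
      have "4 * ((x' - x) * (v - y) - (y' - y) * (u - x)) =
          (2 * x' - 2 * x) * (2 * v - 2 * y) - (2 * y' - 2 * y) * (2 * u - 2 * x)"
        by (simp add: algebra_simps)
      also have "\<dots> = g * (2 * k * P + 4 * (q * u - p * v))"
        unfolding half P_def by (simp add: algebra_simps power2_eq_square)
      finally have 1: "4 * ((x' - x) * (v - y) - (y' - y) * (u - x)) = \<dots>" .
      have "4 * ((x - u) * (x' - u) + (y - v) * (y' - v)) =
          (2 * x - 2 * u) * (2 * x' - 2 * u) + (2 * y - 2 * v) * (2 * y' - 2 * v)"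
        by (simp add: algebra_simps)
      also have "\<dots> = 4 * (u\<^sup>2 + v\<^sup>2) + k * (k * P + 4 * (q * u - p * v)) - g\<^sup>2 * P"
        unfolding half P_def by (simp add: algebra_simps power2_eq_square)
      also have "\<dots> = k * (2 * k * P + 4 * (q * u - p * v))"
        unfolding uv N4 by (simp add: algebra_simps power2_eq_square)
      finally show ?thesis
        using 1 by algebra
    qed
    show "P > 0"
      unfolding P_def using cop by (auto simp: sum_power2_gt_zero_iff)
    show "P mod 4 = 1 \<or> P mod 4 = 2" "P mod 3 \<noteq> 0"
      unfolding P_def using coprime_sum_squares_mod[OF cop] by blast+
    show "g > 0"
      by (rule g)
    show "P mod 4 = 2" if "odd g"
    proof -
      \<comment> \<open>\<open>x + y\<close> and \<open>x' + y'\<close> both have the parity of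
        \<open>N\<close>, so the two differences agree in parity; an odd \<open>g\<close> passes
        this on to \<open>p\<close> and \<open>q\<close>.\<close>
      have "even (x\<^sup>2 + y\<^sup>2) \<longleftrightarrow> even (x'\<^sup>2 + y'\<^sup>2)"
        using circ by simp
      then have "even (x - x') \<longleftrightarrow> even (y - y')"
        by auto
      then have "even p \<longleftrightarrow> even q"
        unfolding pq using that by simp
      then have "even P"
        by (simp add: P_def)
      with coprime_sum_squares_mod(1)[OF cop] show ?thesis
        unfolding P_def[symmetric] by presburger
    qed
  qed
qed

section \<open>Parity of the perimeter and exclusion of 2, 4, 6 and 10\<close>

text \<open>At every vertex \<open>x + y\<close> has the parity of \<open>N\<close>, so the gcd of a
  side is odd exactly when the first coordinates of its ends differ in parity. Around a triangle
  this happens for zero or two sides.\<close>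

lemma even_lattice_perimeter:
  fixes x1 y1 x2 y2 x3 y3 :: int
  assumes "x1\<^sup>2 + y1\<^sup>2 = N" "x2\<^sup>2 + y2\<^sup>2 = N" "x3\<^sup>2 + y3\<^sup>2 = N"
  shows "even (gcd (x1 - x2) (y1 - y2) + gcd (x2 - x3) (y2 - y3) + gcd (x3 - x1) (y3 - y1))"
proof -
  have "even (x1\<^sup>2 + y1\<^sup>2) \<longleftrightarrow> even N" "even (x2\<^sup>2 + y2\<^sup>2) \<longleftrightarrow> even N" "even (x3\<^sup>2 + y3\<^sup>2) \<longleftrightarrow> even N"
    using assms by simp_all
  then show ?thesis
    by auto
qed

text \<open>This is \<open>cot A cot B + cot B cot C + cot C cot A = 1\<close>.\<close>

lemma cot_relation:
  fixes x1 y1 x2 y2 x3 y3 a b c ka kb kc :: int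
  defines "D \<equiv> (x2 - x1) * (y3 - y1) - (y2 - y1) * (x3 - x1)"
  assumes D: "D \<noteq> 0"
    and "kc * D = c * ((x1 - x3) * (x2 - x3) + (y1 - y3) * (y2 - y3))"
      "ka * D = a * ((x2 - x1) * (x3 - x1) + (y2 - y1) * (y3 - y1))"
      "kb * D = b * ((x1 - x2) * (x3 - x2) + (y1 - y2) * (y3 - y2))"
  shows "a * kb * kc + b * ka * kc + c * ka * kb = a * b * c"
proof -
  have "(a * kb * kc + b * ka * kc + c * ka * kb) * D\<^sup>2 =
      a * (kb * D) * (kc * D) + b * (ka * D) * (kc * D) + c * (ka * D) * (kb * D)"
    by (simp add: power2_eq_square algebra_simps)
  also have "\<dots> = a * b * c * D\<^sup>2"
    unfolding assms(3-5) by (simp add: D_def power2_eq_square algebra_simps)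
  finally show ?thesis
    using D by simp
qed

text \<open>The cotangent relation determines \<open>kc\<close> from the rest, and
  \<open>kc > 0\<close> forces \<open>ka * kb < a * b\<close>. This leaves a finite search, whose
  survivors violate the congruences on \<open>P\<close>, \<open>Q\<close>, \<open>R\<close>.\<close>

lemma cot_relation_sorted:
  fixes a b c ka kb kc P Q R M :: int
  assumes ord: "0 < a" "a \<le> b" "b \<le> c" and l: "a + b + c \<in> {2, 4, 6, 10}"
    and k: "ka > 0" "kb > 0" "kc > 0" "a * kb * kc + b * ka * kc + c * ka * kb = a * b * c"
    and M: "M > 0" "M = P * (a\<^sup>2 + ka\<^sup>2)" "M = Q * (b\<^sup>2 + kb\<^sup>2)" "M = R * (c\<^sup>2 + kc\<^sup>2)"
    and P: "P mod 4 = 1 \<or> P mod 4 = 2" "P mod 3 \<noteq> 0" "odd a \<Longrightarrow> P mod 4 = 2"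
    and Q: "Q mod 4 = 1 \<or> Q mod 4 = 2" "Q mod 3 \<noteq> 0" "odd b \<Longrightarrow> Q mod 4 = 2"
    and R: "R mod 4 = 1 \<or> R mod 4 = 2" "R mod 3 \<noteq> 0" "odd c \<Longrightarrow> R mod 4 = 2"
  shows False
proof -
  define d where "d = a * kb + b * ka"
  have d: "d > 0"
    unfolding d_def using ord k by (simp add: add_pos_pos)
  have kc: "kc * d = c * (a * b - ka * kb)"
    unfolding d_def using k(4) by (simp add: algebra_simps)
  have "ka * kb < a * b"
    using kc d k ord by (metis diff_gt_0_iff_gt mult_pos_pos order_less_le_trans zero_less_mult_pos)
  moreover have "ka \<le> ka * kb" "kb \<le> ka * kb"
    using k by simp_all
  ultimately have kab: "ka * kb < a * b" "ka \<in> set [1..a * b - 1]" "kb \<in> set [1..a * b - 1]"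
    using k(1,2) by (simp_all only: set_upto atLeastAtMost_iff) linarith+
  have dvd: "d dvd c * (a * b - ka * kb)"
    using kc by (metis dvd_triv_right)
  \<comment> \<open>For \<open>a = b = 1\<close> the range of \<open>ka\<close> would be
    empty.\<close>
  have "a * b \<noteq> 1"
    using kab(2) by auto
  then have "b \<noteq> 1"
    using ord by auto
  \<comment> \<open>All sorted triples with an admissible sum and \<open>b \<noteq> 1\<close>.
    Lattice lengths need not obey the triangle inequality, so triples such as \<open>(2,2,6)\<close>
    occur.\<close>
  have abc: "(a, b, c) \<in> {(2,2,2), (1,2,3), (2,2,6), (2,4,4), (1,3,6), (1,4,5), (1,2,7), (2,3,5), (3,3,4)}"
  proof -
    have s: "a + b + c = 2 \<or> a + b + c = 4 \<or> a + b + c = 6 \<or> a + b + c = 10"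
      using l by simp
    then have "a \<in> {1..3}" "b \<in> {2..4}"
      using ord \<open>b \<noteq> 1\<close> by (simp_all, linarith+)
    then have "a \<in> {1,2,3}" "b \<in> {2,3,4}"
      by (simp_all, presburger+)
    then show ?thesis
      using ord s by (elim insertE emptyE; simp; linarith)
  qed
  \<comment> \<open>The pairs \<open>(ka, kb)\<close> for which the forced value of
    \<open>kc\<close> is an integer.\<close>
  define cand where "cand = (\<lambda>a b c :: int. filter (\<lambda>(x, y). x * y < a * b \<and> (a * y + b * x) dvd c * (a * b - x * y))
    (List.product [1..a * b - 1] [1..a * b - 1]))"
  have "(ka, kb) \<in> set (cand a b c)"
    using kab dvd by (simp add: cand_def d_def del: set_upto)
  moreover have "cand 2 2 2 = []" "cand 1 2 3 = [(1,1)]" "cand 2 2 6 = [(1,2), (2,1)]"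
    "cand 2 4 4 = [(1,2), (1,3)]" "cand 1 3 6 = [(1,1)]" "cand 1 4 5 = [(1,1)]" "cand 1 2 7 = []"
    "cand 2 3 5 = [(1,1), (2,2)]" "cand 3 3 4 = [(1,3), (3,1)]"
    by (simp_all add: cand_def upto_rec1)
  ultimately consider
      "(a, b, c, ka, kb) = (1,2,3,1,1)" | "(a, b, c, ka, kb) = (1,3,6,1,1)"
    | "(a, b, c, ka, kb) = (1,4,5,1,1)" | "(a, b, c, ka, kb) = (2,2,6,1,2)"
    | "(a, b, c, ka, kb) = (2,2,6,2,1)" | "(a, b, c, ka, kb) = (2,3,5,1,1)"
    | "(a, b, c, ka, kb) = (2,3,5,2,2)" | "(a, b, c, ka, kb) = (2,4,4,1,2)"
    | "(a, b, c, ka, kb) = (2,4,4,1,3)" | "(a, b, c, ka, kb) = (3,3,4,1,3)"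
    | "(a, b, c, ka, kb) = (3,3,4,3,1)"
    using abc by (elim insertE emptyE) auto
  \<comment> \<open>In each case two of the expressions for \<open>M\<close> make one of
    \<open>P\<close>, \<open>Q\<close>, \<open>R\<close> divisible by 4, or by 3 when the triple is
    \<open>(3,3,4)\<close>.\<close>
  then show False
  proof cases
    case 1
    then have "5 * Q = 10 * R" "Q mod 4 \<noteq> 0" "R mod 4 = 2"
      using M Q R kc by (auto simp: d_def)
    then show False
      by presburger
  next
    case 2
    then have "2 * P = 45 * R" "P mod 4 = 2" "R mod 4 \<noteq> 0"
      using M P R kc by (auto simp: d_def)
    then show False
      by presburger
  next
    case 3
    then have "17 * Q = 34 * R" "Q mod 4 \<noteq> 0" "R mod 4 = 2"
      using M Q R kc by (auto simp: d_def)
    then show False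
      by presburger
  next
    case 4
    then have "5 * P = 8 * Q" "P mod 4 \<noteq> 0"
      using M P by auto
    then show False
      by presburger
  next
    case 5
    then have "8 * P = 5 * Q" "Q mod 4 \<noteq> 0"
      using M Q by auto
    then show False
      by presburger
  next
    case 6
    then have "5 * P = 10 * Q" "P mod 4 \<noteq> 0" "Q mod 4 = 2"
      using M P Q by auto
    then show False
      by presburger
  next
    case 7
    then have "8 * P = 13 * Q" "Q mod 4 \<noteq> 0"
      using M Q by auto
    then show False
      by presburger
  next
    case 8
    then have "5 * P = 20 * Q" "P mod 4 \<noteq> 0"
      using M P by auto
    then show False
      by presburger
  next
    case 9
    then have "5 * P = 20 * R" "P mod 4 \<noteq> 0"
      using M P R kc by (auto simp: d_def)
    then show False
      by presburger
  next
    case 10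
    then have "10 * P = 18 * Q" "P mod 3 \<noteq> 0"
      using M P Q by auto
    then show False
      by presburger
  next
    case 11
    then have "18 * P = 10 * Q" "Q mod 3 \<noteq> 0"
      using M P Q by auto
    then show False
      by presburger
  qed
qed

text \<open>The hypotheses are invariant under simultaneous permutation of the sides and their data,
  so the sides may be sorted.\<close>

lemma cot_relation_small:
  fixes a b c ka kb kc P Q R M :: int
  assumes pos: "0 < a" "0 < b" "0 < c" and l: "a + b + c \<in> {2, 4, 6, 10}"
    and k: "ka > 0" "kb > 0" "kc > 0" "a * kb * kc + b * ka * kc + c * ka * kb = a * b * c"
    and M: "M > 0" "M = P * (a\<^sup>2 + ka\<^sup>2)" "M = Q * (b\<^sup>2 + kb\<^sup>2)" "M = R * (c\<^sup>2 + kc\<^sup>2)"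
    and P: "P mod 4 = 1 \<or> P mod 4 = 2" "P mod 3 \<noteq> 0" "odd a \<Longrightarrow> P mod 4 = 2"
    and Q: "Q mod 4 = 1 \<or> Q mod 4 = 2" "Q mod 3 \<noteq> 0" "odd b \<Longrightarrow> Q mod 4 = 2"
    and R: "R mod 4 = 1 \<or> R mod 4 = 2" "R mod 3 \<noteq> 0" "odd c \<Longrightarrow> R mod 4 = 2"
  shows False
proof -
  have l': "a + c + b \<in> {2, 4, 6, 10}" "b + a + c \<in> {2, 4, 6, 10}" "b + c + a \<in> {2, 4, 6, 10}"
    "c + a + b \<in> {2, 4, 6, 10}" "c + b + a \<in> {2, 4, 6, 10}"
    using l by (simp_all add: ac_simps)
  have k': "a * kc * kb + c * ka * kb + b * ka * kc = a * c * b"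
    "b * ka * kc + a * kb * kc + c * kb * ka = b * a * c"
    "b * kc * ka + c * kb * ka + a * kb * kc = b * c * a"
    "c * ka * kb + a * kc * kb + b * kc * ka = c * a * b"
    "c * kb * ka + b * kc * ka + a * kc * kb = c * b * a"
    using k(4) by (simp_all add: ac_simps)
  consider "a \<le> b" "b \<le> c" | "a \<le> c" "c \<le> b" | "b \<le> a" "a \<le> c" | "b \<le> c" "c \<le> a"
    | "c \<le> a" "a \<le> b" | "c \<le> b" "b \<le> a"
    by linarith
  then show False
  proof cases
    case 1
    show ?thesis
      by (rule cot_relation_sorted[OF pos(1) 1 l k M P Q R])
  next
    case 2
    show ?thesis
      by (rule cot_relation_sorted[OF pos(1) 2 l'(1) k(1,3,2) k'(1) M(1,2,4,3) P R Q])
  next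
    case 3
    show ?thesis
      by (rule cot_relation_sorted[OF pos(2) 3 l'(2) k(2,1,3) k'(2) M(1,3,2,4) Q P R])
  next
    case 4
    show ?thesis
      by (rule cot_relation_sorted[OF pos(2) 4 l'(3) k(2,3,1) k'(3) M(1,3,4,2) Q R P])
  next
    case 5
    show ?thesis
      by (rule cot_relation_sorted[OF pos(3) 5 l'(4) k(3,1,2) k'(4) M(1,4,2,3) R P Q])
  next
    case 6
    show ?thesis
      by (rule cot_relation_sorted[OF pos(3) 6 l'(5) k(3,2,1) k'(5) M(1,4,3,2) R Q P])
  qed
qed

lemma centered_acute_perimeter_not_small:
  assumes "centered_acute x1 y1 x2 y2 x3 y3"
  shows "gcd (x1 - x2) (y1 - y2) + gcd (x2 - x3) (y2 - y3) + gcd (x3 - x1) (y3 - y1) \<notin> {2, 4, 6, 10}"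
proof
  define D where "D = (x2 - x1) * (y3 - y1) - (y2 - y1) * (x3 - x1)"
  define N where "N = x1\<^sup>2 + y1\<^sup>2"
  \<comment> \<open>Each side is named after its opposite vertex: \<open>a\<close>,
    \<open>b\<close>, \<open>c\<close> face vertices 1, 2, 3.\<close>
  define a b c where "a = gcd (x2 - x3) (y2 - y3)" and "b = gcd (x3 - x1) (y3 - y1)"
    and "c = gcd (x1 - x2) (y1 - y2)"
  note acute = assms[unfolded centered_acute_def]
  note ne = centered_acute_distinct[OF assms]
  have N: "x1\<^sup>2 + y1\<^sup>2 = N" "x2\<^sup>2 + y2\<^sup>2 = N" "x3\<^sup>2 + y3\<^sup>2 = N"
    using acute by (simp_all add: N_def)
  have D: "D \<noteq> 0"
    using acute by (simp add: D_def)
  assume "c + a + b \<in> {2, 4, 6, 10}"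
  then have l: "a + b + c \<in> {2, 4, 6, 10}"
    by (simp add: ac_simps)
  obtain kc R where c: "4 * N = R * (c\<^sup>2 + kc\<^sup>2)" "R > 0" "c > 0"
      "R mod 4 = 1 \<or> R mod 4 = 2" "R mod 3 \<noteq> 0" "odd c \<Longrightarrow> R mod 4 = 2"
    and kc: "kc * ((x2 - x1) * (y3 - y1) - (y2 - y1) * (x3 - x1)) =
      c * ((x1 - x3) * (x2 - x3) + (y1 - y3) * (y2 - y3))"
    using lattice_chord[OF N(1,2) ne(1), folded c_def] N(3) by metis
  obtain ka P where a: "4 * N = P * (a\<^sup>2 + ka\<^sup>2)" "P > 0" "a > 0"
      "P mod 4 = 1 \<or> P mod 4 = 2" "P mod 3 \<noteq> 0" "odd a \<Longrightarrow> P mod 4 = 2"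
    and ka: "ka * ((x3 - x2) * (y1 - y2) - (y3 - y2) * (x1 - x2)) =
      a * ((x2 - x1) * (x3 - x1) + (y2 - y1) * (y3 - y1))"
    using lattice_chord[OF N(2,3) ne(2), folded a_def] N(1) by metis
  obtain kb Q where b: "4 * N = Q * (b\<^sup>2 + kb\<^sup>2)" "Q > 0" "b > 0"
      "Q mod 4 = 1 \<or> Q mod 4 = 2" "Q mod 3 \<noteq> 0" "odd b \<Longrightarrow> Q mod 4 = 2"
    and kb: "kb * ((x1 - x3) * (y2 - y3) - (y1 - y3) * (x2 - x3)) =
      b * ((x3 - x2) * (x1 - x2) + (y3 - y2) * (y1 - y2))"
    using lattice_chord[OF N(3,1) ne(3), folded b_def] N(2) by metis
  \<comment> \<open>The determinants of the three chords coincide by cyclic symmetry.\<close>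
  have cot: "kc * D = c * ((x1 - x3) * (x2 - x3) + (y1 - y3) * (y2 - y3))"
      "ka * D = a * ((x2 - x1) * (x3 - x1) + (y2 - y1) * (y3 - y1))"
      "kb * D = b * ((x1 - x2) * (x3 - x2) + (y1 - y2) * (y3 - y2))"
    using ka kb kc unfolding D_def by (simp_all add: algebra_simps)
  have kD: "ka * D > 0" "kb * D > 0" "kc * D > 0"
    unfolding cot using a(3) b(3) c(3) acute by simp_all
  have "a * kb * kc + b * ka * kc + c * ka * kb = a * b * c"
    using cot_relation[OF D[unfolded D_def] cot[unfolded D_def]] .
  \<comment> \<open>All three factors share the sign of \<open>D\<close>, which depends on the
    orientation; absolute values make them positive and keep their pairwise products.\<close>
  moreover have "\<bar>kb\<bar> * \<bar>kc\<bar> = kb * kc" "\<bar>ka\<bar> * \<bar>kc\<bar> = ka * kc" "\<bar>ka\<bar> * \<bar>kb\<bar> = ka * kb"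
    using kD by (auto simp: zero_less_mult_iff)
  ultimately have "a * \<bar>kb\<bar> * \<bar>kc\<bar> + b * \<bar>ka\<bar> * \<bar>kc\<bar> + c * \<bar>ka\<bar> * \<bar>kb\<bar> = a * b * c"
    by (simp add: mult.assoc)
  moreover have "\<bar>ka\<bar> > 0" "\<bar>kb\<bar> > 0" "\<bar>kc\<bar> > 0"
    using kD by auto
  moreover have "4 * N > 0"
    unfolding a(1) using a(2,3) by (simp add: add_pos_nonneg)
  ultimately show False
    using cot_relation_small[OF a(3) b(3) c(3) l, of "\<bar>ka\<bar>" "\<bar>kb\<bar>" "\<bar>kc\<bar>" "4 * N" P Q R]
      a(1,4-6) b(1,4-6) c(1,4-6) by simp
qed

section \<open>Construction of the attained perimeters\<close>

text \<open>\<open>gcd (u - v) (u + v) = gcd (u - v) (2 * v)\<close>, and \<open>u - v\<close> is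
  odd and coprime to \<open>v\<close>.\<close>

lemma coprime_diff_add:
  fixes u v :: int
  assumes "coprime u v" "odd (u + v)"
  shows "coprime (u - v) (u + v)"
proof -
  have "coprime (u - v) v"
    using assms(1) by (metis coprime_commute diff_add_cancel coprime_add_one_left gcd_add1 coprime_iff_gcd_eq_1)
  moreover have "coprime (u - v) 2"
    using assms(2) by simp
  ultimately have "coprime (u - v) (2 * v)"
    by simp
  moreover have "gcd (u - v) (2 * v) = gcd (u - v) (u + v)"
    using gcd_add2[of "u - v" "2 * v"] by (simp add: add.commute)
  ultimately show ?thesis
    by (simp only: coprime_iff_gcd_eq_1)
qed

lemma centered_acute_family:
  fixes u v :: int
  assumes "0 < v" "v < u"
  shows "centered_acute (- u) (- v) u (- v) v u"
    and "gcd (- u - u) (- v - (- v)) + gcd (u - v) (- v - u) + gcd (v - (- u)) (u - (- v)) =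
      3 * u + v + gcd (u - v) (u + v)"
proof -
  \<comment> \<open>Half the inner products at the three vertices, the last two factors belonging to
    \<open>(v, u)\<close>.\<close>
  have "u * (u + v) > 0" "u * (u - v) > 0" "(u + v) * v > 0"
    using assms by simp_all
  then show "centered_acute (- u) (- v) u (- v) v u"
    unfolding centered_acute_def by (simp add: power2_eq_square algebra_simps)
  have "gcd (u - v) (- v - u) = gcd (u - v) (u + v)"
    by (metis add.commute gcd_neg2_int minus_add_distrib diff_conv_add_uminus)
  then show "gcd (- u - u) (- v - (- v)) + gcd (u - v) (- v - u) + gcd (v - (- u)) (u - (- v)) =
      3 * u + v + gcd (u - v) (u + v)"
    using assms by (simp add: add.commute)
qed

lemma exists_centered_acute:
  fixes l :: int
  assumes "even l" "l = 8 \<or> l \<ge> 12"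
  shows "\<exists>x1 y1 x2 y2 x3 y3. centered_acute x1 y1 x2 y2 x3 y3 \<and>
    gcd (x1 - x2) (y1 - y2) + gcd (x2 - x3) (y2 - y3) + gcd (x3 - x1) (y3 - y1) = l"
proof -
  have family: ?thesis if "0 < v" "v < u" "l = 3 * u + v + gcd (u - v) (u + v)" for u v
    using centered_acute_family[OF that(1,2)] that(3) by metis
  have "l mod 6 = 0 \<or> l mod 6 = 2 \<or> l mod 6 = 4"
    using assms(1) by presburger
  then consider "l mod 6 = 0" | "l mod 6 = 2" | "l mod 6 = 4"
    by blast
  then show ?thesis
  proof cases
    case 1
    define m where "m = l div 6"
    have m: "l = 6 * m" "m \<ge> 2"
      using 1 assms(2) by (auto simp: m_def)
    \<comment> \<open>For \<open>v = 1\<close> and odd \<open>u\<close> the gcd is that of two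
      consecutive even numbers, namely 2, and the perimeter is \<open>3 * u + 3\<close>.\<close>
    have "gcd (2 * m - 2) (2 * m) = gcd (2 * (m - 1)) (2 * m)"
      by (simp add: algebra_simps)
    also have "\<dots> = 2 * gcd (m - 1) m"
      by (simp only: gcd_mult_distrib_int[symmetric])
    also have "gcd (m - 1) m = 1"
      using coprime_diff_one_left by (metis coprime_iff_gcd_eq_1)
    finally show ?thesis
      using m by (intro family[of 1 "2 * m - 1"]) auto
  next
    case 2
    define m where "m = l div 6"
    have m: "l = 6 * m + 2" "m \<ge> 1"
      using 2 assms(2) unfolding m_def by presburger+
    \<comment> \<open>For \<open>v = 1\<close> and even \<open>u\<close> the gcd is 1, and the
      perimeter is \<open>3 * u + 2\<close>.\<close>
    have "gcd (2 * m - 1) (2 * m + 1) = 1"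
      using coprime_diff_add[of "2 * m" 1] by (simp add: coprime_iff_gcd_eq_1)
    then show ?thesis
      using m by (intro family[of 1 "2 * m"]) auto
  next
    case 3
    define m where "m = l div 6"
    have m: "l = 6 * m + 4" "m \<ge> 2"
      using 3 assms(2) unfolding m_def by presburger+
    have cop: "coprime x 3" if "\<not> 3 dvd x" for x :: int
    proof -
      have "x mod 3 = 1 \<or> x mod 3 = 2"
        using that by presburger
      moreover have "gcd 3 (1 :: int) = 1" "gcd 3 (2 :: int) = 1"
        by simp_all
      ultimately have "gcd x 3 = 1"
        by (metis gcd_red_int)
      then show ?thesis
        by (simp only: coprime_iff_gcd_eq_1)
    qed
    \<comment> \<open>Residue 4 is reached by \<open>v = 3\<close>, \<open>u = 2 * m\<close> unless
      3 divides \<open>m\<close>. Then \<open>v = 9\<close>, \<open>u = 2 * (m - 1)\<close> gives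
      the same perimeter, but \<open>v < u\<close> requires \<open>m \<ge> 6\<close>; only
      \<open>m = 3\<close>, perimeter 22, is left over.\<close>
    have "\<not> 3 dvd m \<or> m = 3 \<or> 3 dvd m \<and> m \<ge> 6"
      using m(2) by presburger
    then consider "\<not> 3 dvd m" | "m = 3" | "3 dvd m" "m \<ge> 6"
      by blast
    then show ?thesis
    proof cases
      case 1
      then have "\<not> 3 dvd 2 * m"
        by presburger
      then have "gcd (2 * m - 3) (2 * m + 3) = 1"
        using coprime_diff_add[of "2 * m" 3] cop[of "2 * m"] by (simp add: coprime_iff_gcd_eq_1)
      then show ?thesis
        using m by (intro family[of 3 "2 * m"]) auto
    next
      case 2
      \<comment> \<open>The squared norm is 50 and the lattice lengths are 14, 6 and 2.\<close>
      have "centered_acute (- 7) (- 1) 7 (- 1) (- 5) 5"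
        by (simp add: centered_acute_def)
      moreover have "gcd (- 7 - 7) (- 1 - - 1) + gcd (7 - - 5) (- 1 - 5) + gcd (- 5 - - 7) (5 - - 1) = l"
        using m(1) 2 by simp
      ultimately show ?thesis
        by blast
    next
      case 3
      then have "\<not> 3 dvd 2 * (m - 1)"
        by presburger
      then have "coprime (2 * (m - 1)) (3 * 3)"
        using cop by (simp only: coprime_mult_right_iff) simp
      then have "gcd (2 * (m - 1) - 9) (2 * (m - 1) + 9) = 1"
        using coprime_diff_add[of "2 * (m - 1)" 9] by (simp add: coprime_iff_gcd_eq_1)
      then show ?thesis
        using m 3 by (intro family[of 9 "2 * (m - 1)"]) auto
    qed
  qed
qed

theorem theorem2:
  fixes l :: nat
  assumes "l \<ge> 1"
  shows "(\<exists>a b c :: real ^ 2. lattice_triangle a b c \<and> acute_triangle a b c \<and>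
            lattice_perimeter a b c = l \<and> circumcenter a b c \<in> lattice_points) \<longleftrightarrow>
         even l \<and> (l = 8 \<or> l \<ge> 12)"
  unfolding acute_lattice_triangle_iff_centered_acute
proof
  assume "\<exists>x1 y1 x2 y2 x3 y3. centered_acute x1 y1 x2 y2 x3 y3 \<and>
    gcd (x1 - x2) (y1 - y2) + gcd (x2 - x3) (y2 - y3) + gcd (x3 - x1) (y3 - y1) = int l"
  then obtain x1 y1 x2 y2 x3 y3 where acute: "centered_acute x1 y1 x2 y2 x3 y3"
    and l: "gcd (x1 - x2) (y1 - y2) + gcd (x2 - x3) (y2 - y3) + gcd (x3 - x1) (y3 - y1) = int l"
    by blast
  have "even (int l)"
    unfolding l[symmetric] using acute
    by (intro even_lattice_perimeter[where N = "x1\<^sup>2 + y1\<^sup>2"]) (simp_all add: centered_acute_def)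
  then have "even l"
    by simp
  moreover have "int l \<notin> {2, 4, 6, 10}"
    using centered_acute_perimeter_not_small[OF acute] unfolding l .
  then have "l \<noteq> 2" "l \<noteq> 4" "l \<noteq> 6" "l \<noteq> 10"
    by auto
  ultimately show "even l \<and> (l = 8 \<or> l \<ge> 12)"
    using assms by presburger
next
  assume "even l \<and> (l = 8 \<or> l \<ge> 12)"
  then show "\<exists>x1 y1 x2 y2 x3 y3. centered_acute x1 y1 x2 y2 x3 y3 \<and>
    gcd (x1 - x2) (y1 - y2) + gcd (x2 - x3) (y2 - y3) + gcd (x3 - x1) (y3 - y1) = int l"
    by (intro exists_centered_acute) auto
qed

end
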